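(* For every standard proof context $\Delta$, relational proof context $\Gamma$, low-level program $c^L$, and assertions $\mathcal{P},\mathcal{Q}\subseteq\Sigma^L\times\Sigma^H\times\mathrm{Prog}^H$: $$\Delta,\Gamma\vdash\langle\mathcal{P}\rangle\,c^L\,\langle\mathcal{Q}\rangle\quad\text{if and only if}\quad\text{for all }X\subseteq\Sigma^H,\ \ \Delta,\mathrm{enc}(\Gamma)\vdash_\forall\{\mathrm{enc}_X(\mathcal{P})\}\,c^L\,\{\mathrm{enc}_X(\mathcal{Q})\}.$$
   Context: $\Sigma^L,\Sigma^H$ are sets of low-level and high-level states. High-level programs $c\in\mathrm{Prog}^H$ have denotational semantics $[\![c]\!]\subseteq\Sigma^H\times\Sigma^H$. Low-level programs may call functions: let $\mathrm{fid}$ be the set of function names; given an environment $\chi:\mathrm{fid}\to\mathscr{P}(\Sigma^L\times\Sigma^L)$ (behaviour of callees), a low-level program $c$ has semantics $[\![c]\!]^\chi\subseteq\Sigma^L\times\Sigma^L$, with in particular $[\![\mathsf{call}\,f]\!]^\chi=\chi(f)$. Assertions are sets; $s\models P$ means $s\in P$. Configuration refinement (high level): $(\sigma_1,c_1)\hookrightarrow(\sigma_2,c_2)$ iff for all $\sigma_3$, $(\sigma_2,\sigma_3)\in[\![c_2]\!]$ implies $(\sigma_1,\sigma_3)\in[\![c_1]\!]$. $\sigma\models\mathrm{wlp}(c,X)$ iff for all $\sigma_0$, $(\sigma,\sigma_0)\in[\![c]\!]$ implies $\sigma_0\in X$. For $X\subseteq\Sigma^H$: $\sigma^L\models\mathrm{enc}_X(\mathcal{P})$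 iff there exist $\sigma^H,c^H$ with $(\sigma^L,\sigma^H,c^H)\models\mathcal{P}$ and $\sigma^H\models\mathrm{wlp}(c^H,X)$. A standard proof context $\Delta$ is a set of function specifications $(f:\Pi(\vec a:A).\{P(\vec a)\}\{Q(\vec a)\})$ with $f\in\mathrm{fid}$, $A$ a type of logical variables, $P(\vec a),Q(\vec a)\subseteq\Sigma^L$. $\mathrm{Valid}(\chi,\Delta)$ holds if for every such specification in $\Delta$, every $\vec a\in A$, every $\sigma_1\models P(\vec a)$ and every $\sigma_2$ with $(\sigma_1,\sigma_2)\in\chi(f)$, we have $\sigma_2\models Q(\vec a)$. A relational proof context $\Gamma$ is a set of specifications $(f:\Pi(\vec a:A).\langle\mathcal{P}(\vec a)\rangle\langle\mathcal{Q}(\vec a)\rangle)$ with $\mathcal{P}(\vec a),\mathcal{Q}(\vec a)\subseteq\Sigma^L\times\Sigma^H\times\mathrm{Prog}^H$. $\mathrm{RelValid}(\chi,\Gamma)$ holds if for every such specification in $\Gamma$, every $\vec a\in A$, every $(\sigma^L_1,\sigma^H_1,c^H_1)\models\mathcal{P}(\vec a)$ and every $\sigma^L_2$ with $(\sigma^L_1,\sigma^L_2)\in\chi(f)$, there exist $\sigma^H_2,c^H_2$ with $(\sigma^H_1,c^H_1)\hookrightarrow(\sigma^H_2,c^H_2)$ and $(\sigma^L_2,\sigma^H_2,c^H_2)\models\mathcal{Q}(\vec a)$. Encoding of contexts: $\mathrm{enc}(\Gamma)$ is the standard proof context containing, for each specification $(f:\Pi(\vec a:A).\langle\mathcal{P}(\vec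 a)\rangle\langle\mathcal{Q}(\vec a)\rangle)$ in $\Gamma$, the specification of $f$ with logical variables $(X,\vec a)$, $X\subseteq\Sigma^H$, $\vec a\in A$, precondition $\mathrm{enc}_X(\mathcal{P}(\vec a))$ and postcondition $\mathrm{enc}_X(\mathcal{Q}(\vec a))$. Contextual triples: $\Delta\vdash_\forall\{P\}\,c\,\{Q\}$ means that for every $\chi$ with $\mathrm{Valid}(\chi,\Delta)$, every $\sigma_1\models P$ and every $\sigma_2$ with $(\sigma_1,\sigma_2)\in[\![c]\!]^\chi$, $\sigma_2\models Q$; a comma between standard contexts denotes union. $\Delta,\Gamma\vdash\langle\mathcal{P}\rangle\,c^L\,\langle\mathcal{Q}\rangle$ means that for every $\chi$ with $\mathrm{Valid}(\chi,\Delta)$ and $\mathrm{RelValid}(\chi,\Gamma)$, every $(\sigma^L_1,\sigma^H_1,c^H_1)\models\mathcal{P}$ and every $\sigma^L_2$ with $(\sigma^L_1,\sigma^L_2)\in[\![c^L]\!]^\chi$, there exist $\sigma^H_2,c^H_2$ with $(\sigma^H_1,c^H_1)\hookrightarrow(\sigma^H_2,c^H_2)$ and $(\sigma^L_2,\sigma^H_2,c^H_2)\models\mathcal{Q}$. *)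

theory Defs
  imports Main
begin

(* Both programming languages are parameters: semH interprets high-level programs, and
   semL c chi interprets the low-level program c when callees behave as given by chi. *)

type_synonym ('f, 'ls) fun_env = "'f \<Rightarrow> ('ls \<times> 'ls) set"
type_synonym ('ls, 'hs, 'hp) rel_assertion = "('ls \<times> 'hs \<times> 'hp) set"

(* FSpec f A P Q is the specification of f with logical variables a ranging over A, precondition
   P a and postcondition Q a. Different specifications in one context may have different types of
   logical variables; these are represented as subsets A of a common type 'v. The values of P and Q
   outside A are irrelevant. *)
datatype ('f, 'v, 's) fspec =
  FSpec (fname: 'f) (lvars: "'v set") (pre: "'v \<Rightarrow> 's set") (post: "'v \<Rightarrow> 's set")

type_synonym ('f, 'v, 'ls) std_ctx = "('f, 'v, 'ls) fspec set"
type_synonym ('f, 'v, 'ls, 'hs, 'hp) rel_ctx = "('f, 'v, 'ls \<times> 'hs \<times> 'hp) fspec set"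

definition refines :: "('hp \<Rightarrow> ('hs \<times> 'hs) set) \<Rightarrow> 'hs \<times> 'hp \<Rightarrow> 'hs \<times> 'hp \<Rightarrow> bool" where
  "refines semH = (\<lambda>(\<sigma>\<^sub>1, c\<^sub>1) (\<sigma>\<^sub>2, c\<^sub>2).
     \<forall>\<sigma>\<^sub>3. (\<sigma>\<^sub>2, \<sigma>\<^sub>3) \<in> semH c\<^sub>2 \<longrightarrow> (\<sigma>\<^sub>1, \<sigma>\<^sub>3) \<in> semH c\<^sub>1)"

definition wlp :: "('hp \<Rightarrow> ('hs \<times> 'hs) set) \<Rightarrow> 'hp \<Rightarrow> 'hs set \<Rightarrow> 'hs set" where
  "wlp semH c X = {\<sigma>. \<forall>\<sigma>\<^sub>0. (\<sigma>, \<sigma>\<^sub>0) \<in> semH c \<longrightarrow> \<sigma>\<^sub>0 \<in> X}"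

definition enc ::
  "('hp \<Rightarrow> ('hs \<times> 'hs) set) \<Rightarrow> 'hs set \<Rightarrow> ('ls, 'hs, 'hp) rel_assertion \<Rightarrow> 'ls set" where
  "enc semH X \<P> = {\<sigma>\<^sub>L. \<exists>\<sigma>\<^sub>H c\<^sub>H. (\<sigma>\<^sub>L, \<sigma>\<^sub>H, c\<^sub>H) \<in> \<P> \<and> \<sigma>\<^sub>H \<in> wlp semH c\<^sub>H X}"

definition Valid :: "('f, 'ls) fun_env \<Rightarrow> ('f, 'v, 'ls) std_ctx \<Rightarrow> bool" where
  "Valid \<chi> \<Delta> \<longleftrightarrow>
     (\<forall>S\<in>\<Delta>. \<forall>a\<in>lvars S. \<forall>\<sigma>\<^sub>1\<in>pre S a. \<forall>\<sigma>\<^sub>2. (\<sigma>\<^sub>1, \<sigma>\<^sub>2) \<in> \<chi> (fname S) \<longrightarrow> \<sigma>\<^sub>2 \<in> post S a)"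

definition RelValid ::
  "('hp \<Rightarrow> ('hs \<times> 'hs) set) \<Rightarrow> ('f, 'ls) fun_env \<Rightarrow> ('f, 'v, 'ls, 'hs, 'hp) rel_ctx \<Rightarrow> bool" where
  "RelValid semH \<chi> \<Gamma> \<longleftrightarrow>
     (\<forall>S\<in>\<Gamma>. \<forall>a\<in>lvars S. \<forall>(\<sigma>\<^sub>L\<^sub>1, \<sigma>\<^sub>H\<^sub>1, c\<^sub>H\<^sub>1)\<in>pre S a. \<forall>\<sigma>\<^sub>L\<^sub>2. (\<sigma>\<^sub>L\<^sub>1, \<sigma>\<^sub>L\<^sub>2) \<in> \<chi> (fname S) \<longrightarrow>
        (\<exists>\<sigma>\<^sub>H\<^sub>2 c\<^sub>H\<^sub>2. refines semH (\<sigma>\<^sub>H\<^sub>1, c\<^sub>H\<^sub>1) (\<sigma>\<^sub>H\<^sub>2, c\<^sub>H\<^sub>2) \<and> (\<sigma>\<^sub>L\<^sub>2, \<sigma>\<^sub>H\<^sub>2, c\<^sub>H\<^sub>2) \<in> post S a))"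

definition enc_spec ::
  "('hp \<Rightarrow> ('hs \<times> 'hs) set) \<Rightarrow> ('f, 'v, 'ls \<times> 'hs \<times> 'hp) fspec \<Rightarrow> ('f, 'hs set \<times> 'v, 'ls) fspec" where
  "enc_spec semH S =
     FSpec (fname S) (UNIV \<times> lvars S)
       (\<lambda>(X, a). enc semH X (pre S a)) (\<lambda>(X, a). enc semH X (post S a))"

definition enc_ctx ::
  "('hp \<Rightarrow> ('hs \<times> 'hs) set) \<Rightarrow> ('f, 'v, 'ls, 'hs, 'hp) rel_ctx \<Rightarrow> ('f, 'hs set \<times> 'v, 'ls) std_ctx" where
  "enc_ctx semH \<Gamma> = enc_spec semH ` \<Gamma>"

(* Union of two contexts whose logical variables live in different types: every specification is
   kept, with its logical variables tagged by Inl or Inr so that both contexts fit into one type. *)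
definition ctx_union ::
  "('f, 'v, 's) fspec set \<Rightarrow> ('f, 'w, 's) fspec set \<Rightarrow> ('f, 'v + 'w, 's) fspec set" where
  "ctx_union \<Delta>\<^sub>1 \<Delta>\<^sub>2 =
     (\<lambda>S. FSpec (fname S) (Inl ` lvars S) (pre S \<circ> projl) (post S \<circ> projl)) ` \<Delta>\<^sub>1 \<union>
     (\<lambda>S. FSpec (fname S) (Inr ` lvars S) (pre S \<circ> projr) (post S \<circ> projr)) ` \<Delta>\<^sub>2"

lemma Valid_ctx_union: "Valid \<chi> (ctx_union \<Delta>\<^sub>1 \<Delta>\<^sub>2) \<longleftrightarrow> Valid \<chi> \<Delta>\<^sub>1 \<and> Valid \<chi> \<Delta>\<^sub>2"
  by (simp add: Valid_def ctx_union_def ball_Un)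

definition std_triple ::
  "('lp \<Rightarrow> ('f, 'ls) fun_env \<Rightarrow> ('ls \<times> 'ls) set) \<Rightarrow>
   ('f, 'v, 'ls) std_ctx \<Rightarrow> 'ls set \<Rightarrow> 'lp \<Rightarrow> 'ls set \<Rightarrow> bool" where
  "std_triple semL \<Delta> P c Q \<longleftrightarrow>
     (\<forall>\<chi>. Valid \<chi> \<Delta> \<longrightarrow> (\<forall>\<sigma>\<^sub>1\<in>P. \<forall>\<sigma>\<^sub>2. (\<sigma>\<^sub>1, \<sigma>\<^sub>2) \<in> semL c \<chi> \<longrightarrow> \<sigma>\<^sub>2 \<in> Q))"

definition rel_triple ::
  "('hp \<Rightarrow> ('hs \<times> 'hs) set) \<Rightarrow> ('lp \<Rightarrow> ('f, 'ls) fun_env \<Rightarrow> ('ls \<times> 'ls) set) \<Rightarrow>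
   ('f, 'v, 'ls) std_ctx \<Rightarrow> ('f, 'w, 'ls, 'hs, 'hp) rel_ctx \<Rightarrow>
   ('ls, 'hs, 'hp) rel_assertion \<Rightarrow> 'lp \<Rightarrow> ('ls, 'hs, 'hp) rel_assertion \<Rightarrow> bool" where
  "rel_triple semH semL \<Delta> \<Gamma> \<P> c\<^sub>L \<Q> \<longleftrightarrow>
     (\<forall>\<chi>. Valid \<chi> \<Delta> \<longrightarrow> RelValid semH \<chi> \<Gamma> \<longrightarrow>
       (\<forall>(\<sigma>\<^sub>L\<^sub>1, \<sigma>\<^sub>H\<^sub>1, c\<^sub>H\<^sub>1)\<in>\<P>. \<forall>\<sigma>\<^sub>L\<^sub>2. (\<sigma>\<^sub>L\<^sub>1, \<sigma>\<^sub>L\<^sub>2) \<in> semL c\<^sub>L \<chi> \<longrightarrow>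
          (\<exists>\<sigma>\<^sub>H\<^sub>2 c\<^sub>H\<^sub>2. refines semH (\<sigma>\<^sub>H\<^sub>1, c\<^sub>H\<^sub>1) (\<sigma>\<^sub>H\<^sub>2, c\<^sub>H\<^sub>2) \<and> (\<sigma>\<^sub>L\<^sub>2, \<sigma>\<^sub>H\<^sub>2, c\<^sub>H\<^sub>2) \<in> \<Q>)))"

end

(* Both kinds of triple, and both kinds of context validity, assert that a relation R on low-level
   states takes a precondition to a postcondition. The two assertions agree for every fixed R:
   refinement preserves weakest liberal preconditions, and conversely, taking X to be the set of
   states reachable from the initial high-level configuration makes the encoded postcondition say
   exactly that this configuration refines to one satisfying the relational postcondition. *)
theory Submission
  imports Defs
begin

lemma refines_iff_wlp:
  "refines semH (\<sigma>\<^sub>1, c\<^sub>1) (\<sigma>\<^sub>2, c\<^sub>2) \<longleftrightarrow> \<sigma>\<^sub>2 \<in> wlp semH c\<^sub>2 (semH c\<^sub>1 `` {\<sigma>\<^sub>1})"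
  by (auto simp: refines_def wlp_def)

lemma wlp_refines:
  assumes "refines semH (\<sigma>\<^sub>1, c\<^sub>1) (\<sigma>\<^sub>2, c\<^sub>2)" and "\<sigma>\<^sub>1 \<in> wlp semH c\<^sub>1 X"
  shows "\<sigma>\<^sub>2 \<in> wlp semH c\<^sub>2 X"
  using assms by (auto simp: refines_def wlp_def)

lemma relational_iff_encoded:
  fixes \<P> \<Q> :: "('ls, 'hs, 'hp) rel_assertion"
  shows "(\<forall>(\<sigma>\<^sub>L\<^sub>1, \<sigma>\<^sub>H\<^sub>1, c\<^sub>H\<^sub>1)\<in>\<P>. \<forall>\<sigma>\<^sub>L\<^sub>2. (\<sigma>\<^sub>L\<^sub>1, \<sigma>\<^sub>L\<^sub>2) \<in> R \<longrightarrow>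
      (\<exists>\<sigma>\<^sub>H\<^sub>2 c\<^sub>H\<^sub>2. refines semH (\<sigma>\<^sub>H\<^sub>1, c\<^sub>H\<^sub>1) (\<sigma>\<^sub>H\<^sub>2, c\<^sub>H\<^sub>2) \<and> (\<sigma>\<^sub>L\<^sub>2, \<sigma>\<^sub>H\<^sub>2, c\<^sub>H\<^sub>2) \<in> \<Q>)) \<longleftrightarrow>
    (\<forall>X. \<forall>\<sigma>\<^sub>1\<in>enc semH X \<P>. \<forall>\<sigma>\<^sub>2. (\<sigma>\<^sub>1, \<sigma>\<^sub>2) \<in> R \<longrightarrow> \<sigma>\<^sub>2 \<in> enc semH X \<Q>)"
    (is "?rel \<longleftrightarrow> ?enc")
proof
  assume ?rel
  then show ?enc
    unfolding enc_def by (blast intro: wlp_refines)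
next
  assume enc: ?enc
  have "\<exists>\<sigma>\<^sub>H\<^sub>2 c\<^sub>H\<^sub>2. refines semH (\<sigma>\<^sub>H\<^sub>1, c\<^sub>H\<^sub>1) (\<sigma>\<^sub>H\<^sub>2, c\<^sub>H\<^sub>2) \<and> (\<sigma>\<^sub>L\<^sub>2, \<sigma>\<^sub>H\<^sub>2, c\<^sub>H\<^sub>2) \<in> \<Q>"
    if P: "(\<sigma>\<^sub>L\<^sub>1, \<sigma>\<^sub>H\<^sub>1, c\<^sub>H\<^sub>1) \<in> \<P>" and R: "(\<sigma>\<^sub>L\<^sub>1, \<sigma>\<^sub>L\<^sub>2) \<in> R" for \<sigma>\<^sub>L\<^sub>1 \<sigma>\<^sub>H\<^sub>1 c\<^sub>H\<^sub>1 \<sigma>\<^sub>L\<^sub>2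
  proof -
    let ?X = "semH c\<^sub>H\<^sub>1 `` {\<sigma>\<^sub>H\<^sub>1}"
    have "\<sigma>\<^sub>L\<^sub>1 \<in> enc semH ?X \<P>"
      \<comment> \<open>The initial configuration is itself the witness: its outcomes lie in
        \<open>?X\<close> by construction.\<close>
      using P by (auto simp: enc_def wlp_def)
    with enc R have "\<sigma>\<^sub>L\<^sub>2 \<in> enc semH ?X \<Q>"
      by blast
    then show ?thesis
      by (auto simp: enc_def refines_iff_wlp)
  qed
  then show ?rel
    by blast
qed

text \<open>Take \<open>R\<close> to be the behaviour of the callee; the quantifier over
  \<open>X\<close> becomes the added logical variable of \<open>enc_spec\<close>.\<close>

lemma RelValid_iff_Valid_enc_ctx: "RelValid semH \<chi> \<Gamma> \<longleftrightarrow> Valid \<chi> (enc_ctx semH \<Gamma>)"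
  unfolding RelValid_def relational_iff_encoded
  by (auto simp: Valid_def enc_ctx_def enc_spec_def)

theorem theorem34:
  fixes semH :: "'hp \<Rightarrow> ('hs \<times> 'hs) set"
    and semL :: "'lp \<Rightarrow> ('f, 'ls) fun_env \<Rightarrow> ('ls \<times> 'ls) set"
    and call :: "'f \<Rightarrow> 'lp"
    and \<Delta> :: "('f, 'v, 'ls) std_ctx"
    and \<Gamma> :: "('f, 'w, 'ls, 'hs, 'hp) rel_ctx"
    and c\<^sub>L :: 'lp
    and \<P> \<Q> :: "('ls, 'hs, 'hp) rel_assertion"
  assumes semL_call: "\<And>f \<chi>. semL (call f) \<chi> = \<chi> f"
  shows "rel_triple semH semL \<Delta> \<Gamma> \<P> c\<^sub>L \<Q> \<longleftrightarrow>
    (\<forall>X :: 'hs set.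
      std_triple semL (ctx_union \<Delta> (enc_ctx semH \<Gamma>)) (enc semH X \<P>) c\<^sub>L (enc semH X \<Q>))"
  \<comment> \<open>With \<open>R\<close> taken as \<open>semL c\<^sub>L \<chi>\<close>, both sides
    differ only in the order of the quantifiers over \<open>X\<close> and
    \<open>\<chi>\<close>.\<close>
  unfolding rel_triple_def std_triple_def relational_iff_encoded
    RelValid_iff_Valid_enc_ctx Valid_ctx_union
  by blast

end
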